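(* Let $(\mathcal{A},[\![\cdot,\cdot]\!],\rhd)$ be a post-Lie-Yamaguti algebra (over $\mathbb{R}$). Define $\{x,y,z\}:=[\![x,y]\!]\rhd z-[x,y,z]$ for $x,y,z\in\mathcal A$, where $[x,y,z]$ is the triple-bracket. Then $(\mathcal{A},[\![\cdot,\cdot]\!],\{\cdot,\cdot,\cdot\})$ is a Lie-Yamaguti algebra.
   Context: For a real vector space $\mathcal{A}$ with bilinear product $\rhd$, put $a_\rhd(x,y,z)=x\rhd(y\rhd z)-(x\rhd y)\rhd z$ and define the triple-bracket $[x,y,z]=a_\rhd(x,y,z)-a_\rhd(y,x,z)$. For $x,y,z\in\mathcal A$ write $(x\cdot y)\rhd z:=a_\rhd(x,y,z)$. Below $\sum_{\circlearrowleft}$ is the sum over cyclic permutations of $(x,y,z)$. Post-Lie-Yamaguti algebra: a real vector space $\mathcal A$ with bilinear operations $\rhd$ and $[\![\cdot,\cdot]\!]$ such that for all $x,y,z,w\in\mathcal A$: (i) $[\![x,x]\!]=0$; (ii) $w\rhd[\![x,y]\!]=[\![w\rhd x,y]\!]+[\![x,w\rhd y]\!]$; (iii) $w\rhd[x,y,z]=[w\rhd x,y,z]+[x,w\rhd y,z]+[x,y,w\rhd z]+(w\cdot[\![x,y]\!])\rhd z-[\![x,y]\!]\rhd(w\rhd z)$; (iv) $\sum_{\circlearrowleft}[x,y,z]=\sum_{\circlearrowleft}\left([\![[\![x,y]\!],z]\!]+[\![x,y]\!]\rhd z\right)$; (v) $\sum_{\circlearrowleft}[[\![x,y]\!],z,w]=\sum_{\circlearrowleft}[\![[\![x,y]\!],z]\!]\rhd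 w$. Lie-Yamaguti algebra: a vector space with a bilinear operation $\circ$ and a trilinear operation $\{\cdot,\cdot,\cdot\}$ such that for all elements: $x\circ x=0$; $\{x,x,y\}=0$; $\sum_{\circlearrowleft}\left(\{x,y,z\}+(x\circ y)\circ z\right)=0$; $\sum_{\circlearrowleft}\{x\circ y,z,w\}=0$; $\{x,y,z\circ w\}=\{x,y,z\}\circ w+z\circ\{x,y,w\}$; $\{x,y,\{u,v,w\}\}=\{\{x,y,u\},v,w\}+\{u,\{x,y,v\},w\}+\{u,v,\{x,y,w\}\}$. *)

theory Defs
  imports "HOL-Analysis.Analysis"
begin

definition trilinear ::
    "('a::real_vector \<Rightarrow> 'b::real_vector \<Rightarrow> 'c::real_vector \<Rightarrow> 'd::real_vector) \<Rightarrow> bool" where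
  "trilinear t \<longleftrightarrow>
     (\<forall>y z. linear (\<lambda>x. t x y z)) \<and> (\<forall>x z. linear (\<lambda>y. t x y z)) \<and> (\<forall>x y. linear (\<lambda>z. t x y z))"

definition cyclic_sum :: "('a \<Rightarrow> 'a \<Rightarrow> 'a \<Rightarrow> 'b::real_vector) \<Rightarrow> 'a \<Rightarrow> 'a \<Rightarrow> 'a \<Rightarrow> 'b" where
  "cyclic_sum f x y z = f x y z + f y z x + f z x y"

text \<open>The associator has the opposite sign to the usual convention for non-associative algebras.
  It is also the meaning of (x \<cdot> y) \<rhd> z.\<close>
definition associator ::
    "('a::real_vector \<Rightarrow> 'a \<Rightarrow> 'a) \<Rightarrow> 'a \<Rightarrow> 'a \<Rightarrow> 'a \<Rightarrow> 'a" where
  "associator tr x y z = tr x (tr y z) - tr (tr x y) z"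

definition triple_bracket ::
    "('a::real_vector \<Rightarrow> 'a \<Rightarrow> 'a) \<Rightarrow> 'a \<Rightarrow> 'a \<Rightarrow> 'a \<Rightarrow> 'a" where
  "triple_bracket tr x y z = associator tr x y z - associator tr y x z"

text \<open>The first argument is the bracket, the second the product \<open>\<rhd>\<close>.\<close>
definition post_Lie_Yamaguti_algebra ::
    "('a::real_vector \<Rightarrow> 'a \<Rightarrow> 'a) \<Rightarrow> ('a \<Rightarrow> 'a \<Rightarrow> 'a) \<Rightarrow> bool" where
  "post_Lie_Yamaguti_algebra br tr \<longleftrightarrow>
     bilinear br \<and> bilinear tr \<and>
     (\<forall>x. br x x = 0) \<and>
     (\<forall>w x y. tr w (br x y) = br (tr w x) y + br x (tr w y)) \<and>
     (\<forall>w x y z. tr w (triple_bracket tr x y z) =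
        triple_bracket tr (tr w x) y z + triple_bracket tr x (tr w y) z
        + triple_bracket tr x y (tr w z)
        + associator tr w (br x y) z - tr (br x y) (tr w z)) \<and>
     (\<forall>x y z. cyclic_sum (triple_bracket tr) x y z =
        cyclic_sum (\<lambda>x y z. br (br x y) z + tr (br x y) z) x y z) \<and>
     (\<forall>x y z w. cyclic_sum (\<lambda>x y z. triple_bracket tr (br x y) z w) x y z =
        cyclic_sum (\<lambda>x y z. tr (br (br x y) z) w) x y z)"

definition Lie_Yamaguti_algebra ::
    "('a::real_vector \<Rightarrow> 'a \<Rightarrow> 'a) \<Rightarrow> ('a \<Rightarrow> 'a \<Rightarrow> 'a \<Rightarrow> 'a) \<Rightarrow> bool" where
  "Lie_Yamaguti_algebra br t \<longleftrightarrow>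
     bilinear br \<and> trilinear t \<and>
     (\<forall>x. br x x = 0) \<and>
     (\<forall>x y. t x x y = 0) \<and>
     (\<forall>x y z. cyclic_sum (\<lambda>x y z. t x y z + br (br x y) z) x y z = 0) \<and>
     (\<forall>x y z w. cyclic_sum (\<lambda>x y z. t (br x y) z w) x y z = 0) \<and>
     (\<forall>x y z w. t x y (br z w) = br (t x y z) w + br z (t x y w)) \<and>
     (\<forall>x y u v w. t x y (t u v w) = t (t x y u) v w + t u (t x y v) w + t u v (t x y w))"

end

theory Submission
  imports Defs
begin

text \<open>Writing \<open>L x\<close> for left multiplication by \<open>x\<close>, the ternary operation is
  \<open>{x, y, \<cdot>} = L (\<lbrakk>x, y\<rbrakk> + x \<rhd> y - y \<rhd> x) - (L x \<circ> L y - L y \<circ> L x)\<close>.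
  Axiom (ii) says that every \<open>L w\<close> is a derivation of the bracket and, given (ii), axiom (iii) says
  that every \<open>L w\<close> is a derivation of \<open>{\<cdot>, \<cdot>, \<cdot>}\<close>. Derivations are closed under differences and
  commutators, so \<open>{x, y, \<cdot>}\<close> is a derivation of both operations. The two cyclic identities are
  restatements of (iv) and (v).\<close>

text \<open>Linearity is included because a commutator applies \<open>d\<close> to the sum that the
  Leibniz rule for \<open>e\<close> produces.\<close>

definition derivation2 :: "('a::real_vector \<Rightarrow> 'a \<Rightarrow> 'a) \<Rightarrow> ('a \<Rightarrow> 'a) \<Rightarrow> bool" where
  "derivation2 b d \<longleftrightarrow> linear d \<and> (\<forall>u v. d (b u v) = b (d u) v + b u (d v))"

definition derivation3 :: "('a::real_vector \<Rightarrow> 'a \<Rightarrow> 'a \<Rightarrow> 'a) \<Rightarrow> ('a \<Rightarrow> 'a) \<Rightarrow> bool" where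
  "derivation3 t d \<longleftrightarrow>
     linear d \<and> (\<forall>u v w. d (t u v w) = t (d u) v w + t u (d v) w + t u v (d w))"

lemma linear_commutator:
  assumes "linear d" "linear e"
  shows "linear (\<lambda>z. d (e z) - e (d z))"
  using linear_compose_sub[OF linear_compose[OF assms(2,1)] linear_compose[OF assms]]
  by (simp add: o_def)

lemma derivation2_diff:
  assumes "bilinear b" "derivation2 b d" "derivation2 b e"
  shows "derivation2 b (\<lambda>z. d z - e z)"
  using assms
  by (auto simp: derivation2_def linear_compose_sub bilinear_lsub bilinear_rsub)

text \<open>The mixed terms \<open>b (d u) (e v)\<close> and \<open>b (e u) (d v)\<close> arise from
  both orders of composition and cancel.\<close>

lemma derivation2_commutator:
  assumes "bilinear b" "derivation2 b d" "derivation2 b e"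
  shows "derivation2 b (\<lambda>z. d (e z) - e (d z))"
  using assms
  by (auto simp: derivation2_def linear_commutator bilinear_lsub bilinear_rsub linear_add)

lemma
  assumes "trilinear t"
  shows trilinear_diff1: "t (x - x') y z = t x y z - t x' y z"
    and trilinear_diff2: "t x (y - y') z = t x y z - t x y' z"
    and trilinear_diff3: "t x y (z - z') = t x y z - t x y z'"
  using assms linear_diff[of "\<lambda>x. t x y z"] linear_diff[of "\<lambda>y. t x y z"]
    linear_diff[of "\<lambda>z. t x y z"]
  by (simp_all add: trilinear_def)

lemma derivation3_diff:
  assumes "trilinear t" "derivation3 t d" "derivation3 t e"
  shows "derivation3 t (\<lambda>z. d z - e z)"
  using assms(2,3)
  by (auto simp: derivation3_def linear_compose_sub trilinear_diff1[OF assms(1)]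
      trilinear_diff2[OF assms(1)] trilinear_diff3[OF assms(1)])

lemma derivation3_commutator:
  assumes "trilinear t" "derivation3 t d" "derivation3 t e"
  shows "derivation3 t (\<lambda>z. d (e z) - e (d z))"
  using assms(2,3)
  by (auto simp: derivation3_def linear_commutator linear_add trilinear_diff1[OF assms(1)]
      trilinear_diff2[OF assms(1)] trilinear_diff3[OF assms(1)])

lemma trilinear_bracket_minus_triple_bracket:
  assumes "bilinear br" "bilinear tr"
  shows "trilinear (\<lambda>x y z. tr (br x y) z - triple_bracket tr x y z)"
  unfolding trilinear_def
  by (intro conjI allI linearI)
    (simp_all add: triple_bracket_def associator_def assms[THEN bilinear_ladd]
      assms[THEN bilinear_radd] assms[THEN bilinear_lmul] assms[THEN bilinear_rmul] algebra_simps)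

theorem proposition8p2:
  fixes br tr :: "'a::real_vector \<Rightarrow> 'a \<Rightarrow> 'a"
  assumes "post_Lie_Yamaguti_algebra br tr"
  shows "Lie_Yamaguti_algebra br (\<lambda>x y z. tr (br x y) z - triple_bracket tr x y z)"
proof -
  define t where "t = (\<lambda>x y z. tr (br x y) z - triple_bracket tr x y z)"
  have br: "bilinear br" and tr: "bilinear tr" and alt: "\<And>x. br x x = 0"
    and ii: "\<And>w x y. tr w (br x y) = br (tr w x) y + br x (tr w y)"
    and iii: "\<And>w x y z. tr w (triple_bracket tr x y z) =
        triple_bracket tr (tr w x) y z + triple_bracket tr x (tr w y) z
        + triple_bracket tr x y (tr w z)
        + associator tr w (br x y) z - tr (br x y) (tr w z)"
    and iv: "\<And>x y z. cyclic_sum (triple_bracket tr) x y z =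
        cyclic_sum (\<lambda>x y z. br (br x y) z + tr (br x y) z) x y z"
    and v: "\<And>x y z w. cyclic_sum (\<lambda>x y z. triple_bracket tr (br x y) z w) x y z =
        cyclic_sum (\<lambda>x y z. tr (br (br x y) z) w) x y z"
    using assms unfolding post_Lie_Yamaguti_algebra_def by blast+
  have t: "trilinear t"
    unfolding t_def using br tr by (rule trilinear_bracket_minus_triple_bracket)
  have linear_tr: "linear (tr w)" for w
    using tr by (simp add: bilinear_def)
  have t_eq: "t x y = (\<lambda>z. tr (br x y + tr x y - tr y x) z - (tr x (tr y z) - tr y (tr x z)))" for x y
    by (simp add: fun_eq_iff t_def triple_bracket_def associator_def bilinear_ladd[OF tr]
        bilinear_lsub[OF tr])
  have tr_br: "derivation2 br (tr w)" for w
    by (simp add: derivation2_def linear_tr ii)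
  \<comment> \<open>The last two terms of \<open>iii\<close> measure how far \<open>tr w\<close> is
    from being a derivation of \<open>tr (br x y) z\<close>, once \<open>ii\<close> splits
    \<open>tr w (br x y)\<close>. They cancel in \<open>t\<close>.\<close>
  have "tr w (t x y z) = t (tr w x) y z + t x (tr w y) z + t x y (tr w z)" for w x y z
    by (simp add: t_def bilinear_rsub[OF tr] iii associator_def ii bilinear_ladd[OF tr])
  then have tr_t: "derivation3 t (tr w)" for w
    by (simp add: derivation3_def linear_tr)
  have t_br: "derivation2 br (t x y)" for x y
    by (subst t_eq) (intro derivation2_diff derivation2_commutator br tr_br)
  have t_t: "derivation3 t (t x y)" for x y
    by (subst t_eq) (intro derivation3_diff derivation3_commutator t tr_t)
  \<comment> \<open>This sum is the right side of \<open>iv\<close> minus its left side; the next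
    one arises from \<open>v\<close> in the same way.\<close>
  have "cyclic_sum (\<lambda>x y z. t x y z + br (br x y) z) x y z = 0" for x y z
    using iv[of x y z] by (simp add: cyclic_sum_def t_def algebra_simps)
  moreover have "cyclic_sum (\<lambda>x y z. t (br x y) z w) x y z = 0" for x y z w
    using v[where x = x and y = y and z = z and w = w] by (simp add: cyclic_sum_def t_def algebra_simps)
  moreover have "t x x y = 0" for x y
    by (simp add: t_def alt triple_bracket_def bilinear_lzero[OF tr])
  \<comment> \<open>The Leibniz rules in \<open>t_br\<close> and \<open>t_t\<close> are the last two
    axioms.\<close>
  ultimately have "Lie_Yamaguti_algebra br t"
    using br t alt t_br t_t
    unfolding Lie_Yamaguti_algebra_def derivation2_def derivation3_def by blast
  then show ?thesis
    by (simp add: t_def)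
qed

end
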